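(* Let $\mathfrak{S}=\langle S,P,A,\delta,+\rangle$ be a Markov decision process and $f$ be an observational adversary. Suppose that $R\subseteq S\times S$ is a bisimulation over $\mathfrak{S}$. Then for any $(u,v)\in R$ and any trace event $\mathcal{T}\subseteq A^*$, we have $\Pr^v(\mathcal{T}\mid\mathfrak{S}_f)=\Pr^u(\mathcal{T}\mid\mathfrak{S}_f)$. That is, $u$ and $v$ induce the same trace distribution under the intervention of $f$.
   Context: A weighted transition system (WTS) is a structure $\mathfrak{S}=\langle S,P,A,\delta,+\rangle$, where $S$ is a countable set of configurations, $P$ is a countable set of nonnegative numbers, $A$ is a countable set of actions, $+$ is addition, and $\delta:S\times A\times S\to P$. It is a Markov decision process (MDP) if there is a constant $q\in P$, $q>0$, such that $\sum_{t\in S}\delta(s,a,t)\in\{0,q\}$ for all $s\in S$, $a\in A$; then $\delta(s,a,t)/q$ is interpreted as the probability of moving to $t$ when action $a$ is selected in $s$. Write $s\to_a t$ if $\delta(s,a,t)\ne0$. A configuration is terminal if it has no successor under any action. A bisimulation over $\mathfrak{S}$ is an equivalence relation $R\subseteq S\times S$ such that $(s,s')\in R$ implies $\sum_{t\in E}\delta(s,a,t)=\sum_{t\in E}\delta(s',a,t)$ for all $a\in A$ and $E\in S/R$. Let $\pi(\mathfrak{S})$ be the set of finite paths $s_0\to_{a_1}s_1\to_{a_2}\cdots\to_{a_n}s_n$ of $\mathfrak{S}$ (including paths of length $0$), and $\mathcal{D}_A$ the set of probability distributions over $A$. The trace of such a path is $tr(\pi)=a_1\cdots a_n\in A^*$.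 An adversary is a map $f:\pi(\mathfrak{S})\to\mathcal{D}_A$ such that, for a path $\pi$ ending in a non-terminal configuration $s_n$, $f(\pi)(a)\neq0$ only if $\delta(s_n,a,s)\ne0$ for some $s\in S$ (values of $f$ at paths ending in a terminal configuration play no role). It is observational if $f(\pi)=f(\pi')$ whenever $tr(\pi)=tr(\pi')$. The adversary induces a Markov chain $\mathfrak{S}_f$ with state set $\pi(\mathfrak{S})$ and actions $A\uplus\{\alpha\}$, $\alpha$ a dummy action: if $\pi'$ extends $\pi=s_0\to_{a_1}\cdots\to_{a_n}s_n$ by one transition $s_n\to_a s_{n+1}$, then the probability of the $a$-labelled transition from $\pi$ to $\pi'$ is $f(\pi)(a)\cdot\delta(s_n,a,s_{n+1})/q$; if $\pi$ ends in a terminal configuration, there is an $\alpha$-labelled self-loop at $\pi$ with probability $1$; all other transition probabilities are $0$. Infinite paths of $\mathfrak{S}_f$ starting from the length-$0$ path $s$ carry the usual cylinder probability measure $\Pr$. A trace event is a set $\mathcal{T}\subseteq A^*$. $\Pr^s(\mathcal{T}\mid\mathfrak{S}_f)$ is the probability, starting from $s$, of the set of infinite paths of $\mathfrak{S}_f$ having some finite prefix whose sequence of actions (trace) lies in $\mathcal{T}$, i.e. $\Pr(\bigcup\{Run_\pi: tr(\pi)\in\mathcal{T},\ \pi\text{ starts at }s\})$ where $Run_\pi$ is the set of infinite paths with prefix $\pi$. *)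

theory Defs
  imports "HOL-Probability.Probability"
begin

section \<open>Weighted transition systems and Markov decision processes\<close>

record ('s, 'a) wts =
  Conf :: "'s set"
  Wts :: "real set"
  Act :: "'a set"
  wt :: "'s \<Rightarrow> 'a \<Rightarrow> 's \<Rightarrow> real"

definition is_wts :: "('s, 'a) wts \<Rightarrow> bool" where
  "is_wts M \<longleftrightarrow> countable (Conf M) \<and> countable (Wts M) \<and> (\<forall>p\<in>Wts M. 0 \<le> p) \<and> countable (Act M) \<and>
     (\<forall>s\<in>Conf M. \<forall>a\<in>Act M. \<forall>t\<in>Conf M. wt M s a t \<in> Wts M)"

text \<open>
  Sums of weights range over possibly infinite sets, so they are taken in \<^typ>\<open>ennreal\<close>,
  where every such sum exists (a divergent one is infinite).
\<close>

definition wt_sum :: "('s, 'a) wts \<Rightarrow> 's \<Rightarrow> 'a \<Rightarrow> 's set \<Rightarrow> ennreal" where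
  "wt_sum M s a E = (\<Sum>\<^sub>\<infinity>t\<in>E. ennreal (wt M s a t))"

definition is_mdp :: "('s, 'a) wts \<Rightarrow> real \<Rightarrow> bool" where
  "is_mdp M q \<longleftrightarrow> is_wts M \<and> q \<in> Wts M \<and> 0 < q \<and>
     (\<forall>s\<in>Conf M. \<forall>a\<in>Act M. wt_sum M s a (Conf M) \<in> {0, ennreal q})"

definition step :: "('s, 'a) wts \<Rightarrow> 's \<Rightarrow> 'a \<Rightarrow> 's \<Rightarrow> bool" where
  "step M s a t \<longleftrightarrow> s \<in> Conf M \<and> a \<in> Act M \<and> t \<in> Conf M \<and> wt M s a t \<noteq> 0"

definition terminal :: "('s, 'a) wts \<Rightarrow> 's \<Rightarrow> bool" where
  "terminal M s \<longleftrightarrow> (\<nexists>a t. step M s a t)"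

definition is_bisimulation :: "('s, 'a) wts \<Rightarrow> ('s \<times> 's) set \<Rightarrow> bool" where
  "is_bisimulation M R \<longleftrightarrow> equiv (Conf M) R \<and>
     (\<forall>(s, s')\<in>R. \<forall>a\<in>Act M. \<forall>E\<in>Conf M // R. wt_sum M s a E = wt_sum M s' a E)"


section \<open>Finite paths and adversaries\<close>

text \<open>
  The path \<open>s\<^sub>0 \<rightarrow> s\<^sub>1 \<rightarrow> \<dots> \<rightarrow> s\<^sub>n\<close> with actions \<open>a\<^sub>1, \<dots>, a\<^sub>n\<close> is represented by
  \<open>(s\<^sub>0, [(a\<^sub>1, s\<^sub>1), \<dots>, (a\<^sub>n, s\<^sub>n)])\<close>.
\<close>

type_synonym ('s, 'a) path = "'s \<times> ('a \<times> 's) list"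

fun last_conf :: "('s, 'a) path \<Rightarrow> 's" where
  "last_conf (s, w) = (if w = [] then s else snd (last w))"

fun extend :: "('s, 'a) path \<Rightarrow> 'a \<Rightarrow> 's \<Rightarrow> ('s, 'a) path" where
  "extend (s, w) a t = (s, w @ [(a, t)])"

fun trace :: "('s, 'a) path \<Rightarrow> 'a list" where
  "trace (s, w) = map fst w"

inductive_set paths :: "('s, 'a) wts \<Rightarrow> ('s, 'a) path set" for M where
  start: "s \<in> Conf M \<Longrightarrow> (s, []) \<in> paths M"
| extend: "\<pi> \<in> paths M \<Longrightarrow> step M (last_conf \<pi>) a t \<Longrightarrow> extend \<pi> a t \<in> paths M"

definition is_adversary :: "('s, 'a) wts \<Rightarrow> (('s, 'a) path \<Rightarrow> 'a pmf) \<Rightarrow> bool" where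
  "is_adversary M f \<longleftrightarrow> (\<forall>\<pi>\<in>paths M. set_pmf (f \<pi>) \<subseteq> Act M \<and>
     (\<not> terminal M (last_conf \<pi>) \<longrightarrow>
        (\<forall>a. pmf (f \<pi>) a \<noteq> 0 \<longrightarrow> (\<exists>s\<in>Conf M. wt M (last_conf \<pi>) a s \<noteq> 0))))"

definition observational :: "('s, 'a) wts \<Rightarrow> (('s, 'a) path \<Rightarrow> 'a pmf) \<Rightarrow> bool" where
  "observational M f \<longleftrightarrow> (\<forall>\<pi>\<in>paths M. \<forall>\<pi>'\<in>paths M. trace \<pi> = trace \<pi>' \<longrightarrow> f \<pi> = f \<pi>')"


section \<open>Infinite runs of a labelled Markov chain\<close>

text \<open>
  A labelled Markov chain is given by its transition probabilities \<open>c x b y\<close> (from state \<open>x\<close> to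
  state \<open>y\<close> with label \<open>b\<close>). A finite or infinite path from a given state \<open>x\<close> is represented by
  the sequence of its transitions (label, target state).
\<close>

definition source :: "'x \<Rightarrow> (nat \<Rightarrow> 'b \<times> 'x) \<Rightarrow> nat \<Rightarrow> 'x" where
  "source x \<omega> n = (case n of 0 \<Rightarrow> x | Suc m \<Rightarrow> snd (\<omega> m))"

definition Runs :: "('x \<Rightarrow> 'b \<Rightarrow> 'x \<Rightarrow> real) \<Rightarrow> 'x \<Rightarrow> (nat \<Rightarrow> 'b \<times> 'x) set" where
  "Runs c x = {\<omega>. \<forall>n. c (source x \<omega> n) (fst (\<omega> n)) (snd (\<omega> n)) \<noteq> 0}"

definition Run :: "('x \<Rightarrow> 'b \<Rightarrow> 'x \<Rightarrow> real) \<Rightarrow> 'x \<Rightarrow> ('b \<times> 'x) list \<Rightarrow> (nat \<Rightarrow> 'b \<times> 'x) set" where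
  "Run c x xs = {\<omega> \<in> Runs c x. \<forall>i<length xs. \<omega> i = xs ! i}"

fun path_prob :: "('x \<Rightarrow> 'b \<Rightarrow> 'x \<Rightarrow> real) \<Rightarrow> 'x \<Rightarrow> ('b \<times> 'x) list \<Rightarrow> real" where
  "path_prob c x [] = 1"
| "path_prob c x ((b, y) # xs) = c x b y * path_prob c y xs"

text \<open>
  The cylinder measure: the measure on the sigma-algebra generated by the cylinders
  \<^term>\<open>Run c x xs\<close> that assigns \<^term>\<open>path_prob c x xs\<close> to each of them. If \<open>xs\<close> is not a path of
  the chain, the cylinder is empty and its assigned value is \<open>0\<close>. \<^const>\<open>extend_measure\<close> yields
  the null measure when no such extension exists. Existence, and measurability of trace events,
  for the chains considered here are shown by the lemmas \<open>emeasure_run_measure_induced_chain\<close> and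
  \<open>sets_run_measure_induced_chain\<close> below.
\<close>

definition run_measure ::
    "('x \<Rightarrow> 'b \<Rightarrow> 'x \<Rightarrow> real) \<Rightarrow> 'x \<Rightarrow> (nat \<Rightarrow> 'b \<times> 'x) measure" where
  "run_measure c x =
     extend_measure (Runs c x) UNIV (Run c x) (\<lambda>xs. ennreal (path_prob c x xs))"


section \<open>The Markov chain induced by an adversary\<close>

text \<open>
  Its states are the finite paths of the decision process. Labels are of type \<^typ>\<open>'a option\<close>,
  with \<^const>\<open>None\<close> as the dummy action.
\<close>

definition induced_chain :: "('s, 'a) wts \<Rightarrow> real \<Rightarrow> (('s, 'a) path \<Rightarrow> 'a pmf) \<Rightarrow>
    ('s, 'a) path \<Rightarrow> 'a option \<Rightarrow> ('s, 'a) path \<Rightarrow> real" where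
  "induced_chain M q f \<pi> b \<pi>' =
     (if \<pi> \<notin> paths M then 0
      else case b of
        None \<Rightarrow> if terminal M (last_conf \<pi>) \<and> \<pi>' = \<pi> then 1 else 0
      | Some a \<Rightarrow>
          if \<exists>t. step M (last_conf \<pi>) a t \<and> \<pi>' = extend \<pi> a t
          then pmf (f \<pi>) a * (wt M (last_conf \<pi>) a (last_conf \<pi>') / q)
          else 0)"

definition trace_prob :: "('s, 'a) wts \<Rightarrow> real \<Rightarrow> (('s, 'a) path \<Rightarrow> 'a pmf) \<Rightarrow>
    's \<Rightarrow> 'a list set \<Rightarrow> real" where
  "trace_prob M q f s T =
     (let c = induced_chain M q f
      in measure (run_measure c (s, []))
           (\<Union>xs\<in>{xs. map fst xs \<in> map Some ` T}. Run c (s, []) xs))"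


section \<open>Existence of the cylinder measure\<close>

lemma source_0 [simp]: "source x \<omega> 0 = x"
  and source_Suc [simp]: "source x \<omega> (Suc n) = snd (\<omega> n)"
  by (simp_all add: source_def)

lemma path_prob_snoc:
  "path_prob c x (xs @ [(b, y)]) =
     path_prob c x xs * c (if xs = [] then x else snd (last xs)) b y"
  by (induction c x xs rule: path_prob.induct) auto

lemma path_prob_conv_prod:
  "path_prob c x xs =
     (\<Prod>i<length xs. c (source x (nth xs) i) (fst (xs ! i)) (snd (xs ! i)))"
proof (induction xs rule: rev_induct)
  case (snoc p xs)
  obtain b y where p: "p = (b, y)" by (cases p)
  have *: "source x ((!) (xs @ [p])) i = source x ((!) xs) i" if "i < length xs" for i
    using that by (cases i) (auto simp: nth_append)
  have **: "source x ((!) (xs @ [p])) (length xs) = (if xs = [] then x else snd (last xs))"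
    by (cases xs rule: rev_cases) (auto simp: nth_append)
  have "(\<Prod>i<length (xs @ [p]). c (source x ((!) (xs @ [p])) i) (fst ((xs @ [p]) ! i)) (snd ((xs @ [p]) ! i))) =
    (\<Prod>i<length xs. c (source x ((!) xs) i) (fst (xs ! i)) (snd (xs ! i))) *
    c (if xs = [] then x else snd (last xs)) b y"
    by (simp only: length_append list.size add_0_right add_Suc_right prod.lessThan_Suc **)
       (auto simp: p nth_append intro!: prod.cong *[unfolded p, THEN arg_cong[where f = "\<lambda>v. c v _ _"]])
  with snoc show ?case
    unfolding p path_prob_snoc by simp
qed simp

lemma emeasure_run_measure:
  fixes c :: "'x \<Rightarrow> 'b \<Rightarrow> 'x \<Rightarrow> real"
  assumes X: "countable X" "x \<in> X"
    and nonneg: "\<And>y b z. y \<in> X \<Longrightarrow> 0 \<le> c y b z"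
    and stochastic: "\<And>y. y \<in> X \<Longrightarrow> (\<integral>\<^sup>+(b, z). ennreal (c y b z) \<partial>count_space UNIV) = 1"
    and closed: "\<And>y b z. y \<in> X \<Longrightarrow> c y b z \<noteq> 0 \<Longrightarrow> z \<in> X"
  shows "emeasure (run_measure c x) (Run c x xs) = ennreal (path_prob c x xs)"
proof -
  define K where "K y = embed_pmf (\<lambda>(b, z). c y b z)" for y
  have pmf_K: "pmf (K y) p = c y (fst p) (snd p)" if "y \<in> X" for y p
    unfolding K_def
    by (subst pmf_embed_pmf)
       (use nonneg[OF that] stochastic[OF that] in \<open>auto simp: case_prod_beta case_prod_unfold\<close>)
  define N where "N = (\<lambda>_::nat. count_space (UNIV :: ('b \<times> 'x) set))"
  define P where "P = (\<lambda>n (\<omega> :: nat \<Rightarrow> 'b \<times> 'x). measure_pmf (K (source x \<omega> n)))"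
  have source_measurable:
    "(\<lambda>\<omega>. source x \<omega> n) \<in> measurable (PiM {0..<m} N) (count_space UNIV)" if "n \<le> m" for n m
  proof (cases n)
    case (Suc k)
    have "(\<lambda>\<omega>. \<omega> k) \<in> measurable (PiM {0..<m} N) (count_space UNIV)"
      using measurable_component_singleton[of k "{0..<m}" N] that Suc by (simp add: N_def)
    from measurable_compose[OF this, of snd "count_space UNIV"] show ?thesis
      using Suc by simp
  qed simp
  interpret IT: Ionescu_Tulcea P N
  proof (rule Ionescu_Tulcea.intro)
    fix i
    have "(\<lambda>y. measure_pmf (K y)) \<in> measurable (count_space UNIV) (subprob_algebra (count_space UNIV))"
      by (auto simp: measurable_def space_subprob_algebra
          intro: prob_space_imp_subprob_space measure_pmf.prob_space_axioms)
    from measurable_compose[OF source_measurable[of i i] this]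
    show "P i \<in> measurable (PiM {0..<i} N) (subprob_algebra (N i))"
      by (simp add: P_def N_def)
  next
    fix i and \<omega> :: "nat \<Rightarrow> 'b \<times> 'x"
    show "prob_space (P i \<omega>)"
      by (simp add: P_def measure_pmf.prob_space_axioms)
  qed
  let ?C = "\<lambda>n. IT.C 0 n (\<lambda>_. undefined)"
  let ?u = "\<lambda>_. undefined :: 'b \<times> 'x"
  have u: "?u \<in> space (PiM {0..<0} N)" by (simp add: space_PiM)
  note space_C = IT.space_C[OF u, simplified] and sets_C = IT.sets_C[OF u, simplified]
  have space_N: "space (N n) = UNIV" for n by (simp add: N_def)
  have sp: "space (PiM J N) = extensional J" for J
    by (auto simp: space_PiM N_def PiE_def)
  have C_Suc: "emeasure (?C (Suc n)) Y = (\<integral>\<^sup>+\<omega>. emeasure (P n \<omega>) {p. (fun_upd \<omega> n p) \<in> Y} \<partial>?C n)"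
    if Y: "Y \<in> sets (PiM {0..<Suc n} N)" for n Y
  proof -
    have "emeasure (?C (Suc n)) Y = (\<integral>\<^sup>+\<omega>. emeasure (IT.eP n \<omega>) Y \<partial>?C n)"
      using IT.measurable_eP[of n] Y
      by (simp, subst emeasure_bind[where N = "PiM {0..<Suc n} N"])
         (auto simp: space_C measurable_cong_sets[OF sets_C refl])
    also have "\<dots> = (\<integral>\<^sup>+\<omega>. emeasure (P n \<omega>) {p. (fun_upd \<omega> n p) \<in> Y} \<partial>?C n)"
      by (intro nn_integral_cong, subst IT.emeasure_eP)
         (auto simp: space_C Y space_N vimage_def)
    finally show ?thesis .
  qed
  have good_sets: "{\<omega> \<in> space (PiM {0..<m} N). source x \<omega> n \<in> X \<and>
        \<omega> n \<in> set_pmf (K (source x \<omega> n))} \<in> sets (PiM {0..<m} N)" if "n < m" for n m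
  proof -
    have [measurable]: "(\<lambda>\<omega>. source x \<omega> n) \<in> measurable (PiM {0..<m} N) (count_space UNIV)"
      using source_measurable that by simp
    have [measurable]: "(\<lambda>\<omega>. \<omega> n) \<in> measurable (PiM {0..<m} N) (count_space UNIV)"
      using measurable_component_singleton[of n "{0..<m}" N] that by (simp add: N_def)
    have "{\<omega> \<in> space (PiM {0..<m} N). \<exists>v\<in>X. source x \<omega> n = v \<and> \<omega> n \<in> set_pmf (K v)}
        \<in> sets (PiM {0..<m} N)"
      using X(1) by measurable
    also have "{\<omega> \<in> space (PiM {0..<m} N). \<exists>v\<in>X. source x \<omega> n = v \<and> \<omega> n \<in> set_pmf (K v)} =
      {\<omega> \<in> space (PiM {0..<m} N). source x \<omega> n \<in> X \<and> \<omega> n \<in> set_pmf (K (source x \<omega> n))}"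
      by auto
    finally show ?thesis .
  qed
  define good where "good n \<omega> \<longleftrightarrow> (\<forall>i<n. source x \<omega> i \<in> X \<and> \<omega> i \<in> set_pmf (K (source x \<omega> i)))" for n \<omega>
  have good_sets': "{\<omega> \<in> space (PiM {0..<m} N). good n \<omega>} \<in> sets (PiM {0..<m} N)" if "n \<le> m" for n m
  proof -
    have "Measurable.pred (PiM {0..<m} N)
       (\<lambda>\<omega>. source x \<omega> i \<in> X \<and> \<omega> i \<in> set_pmf (K (source x \<omega> i)))" if "i \<in> {..<n}" for i
      using good_sets[of i m] \<open>n \<le> m\<close> that by (simp add: pred_def)
    then have "Measurable.pred (PiM {0..<m} N)
       (\<lambda>\<omega>. \<forall>i\<in>{..<n}. source x \<omega> i \<in> X \<and> \<omega> i \<in> set_pmf (K (source x \<omega> i)))"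
      by (rule pred_intros_finite(3)[rotated]) simp_all
    then show ?thesis unfolding pred_def good_def Ball_def lessThan_iff .
  qed
  have good_X: "source x \<omega> n \<in> X" if "good n \<omega>" for n \<omega>
  proof (cases n)
    case (Suc k)
    with that have "source x \<omega> k \<in> X" "\<omega> k \<in> set_pmf (K (source x \<omega> k))"
      by (auto simp: good_def)
    with closed[of "source x \<omega> k" "fst (\<omega> k)" "snd (\<omega> k)"] Suc show ?thesis
      by (auto simp: set_pmf_iff pmf_K)
  qed (use X in simp)
  have source_upd: "source x ((fun_upd \<omega> n p)) i = source x \<omega> i" if "i \<le> n" for \<omega> n p i
    using that by (cases i) auto
  have prob_C: "prob_space (?C n)" for n
    using IT.prob_space_C[OF u] .
  have em_good: "emeasure (?C n) {\<omega> \<in> space (PiM {0..<n} N). good n \<omega>} = 1" for n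
  proof (induction n)
    case 0
    show ?case
      using prob_space.emeasure_space_1[OF prob_C[of 0]] by (simp add: good_def space_PiM)
  next
    case (Suc n)
    have "emeasure (?C (Suc n)) {\<omega> \<in> space (PiM {0..<Suc n} N). good (Suc n) \<omega>} =
      (\<integral>\<^sup>+\<omega>. emeasure (P n \<omega>) {p. (fun_upd \<omega> n p) \<in> {\<omega> \<in> space (PiM {0..<Suc n} N). good (Suc n) \<omega>}} \<partial>?C n)"
      by (rule C_Suc) (rule good_sets'[OF order.refl])
    also have "\<dots> = (\<integral>\<^sup>+\<omega>. indicator {\<omega> \<in> space (PiM {0..<n} N). good n \<omega>} \<omega> \<partial>?C n)"
    proof (intro nn_integral_cong)
      fix \<omega> assume "\<omega> \<in> space (?C n)"
      then have \<omega>: "\<omega> \<in> extensional {0..<n}" by (simp add: space_C sp)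
      have upd: "(fun_upd \<omega> n p) \<in> extensional {0..<Suc n}" for p
        using \<omega> by (auto simp: extensional_def)
      have eq: "good (Suc n) ((fun_upd \<omega> n p)) \<longleftrightarrow> good n \<omega> \<and> p \<in> set_pmf (K (source x \<omega> n))" for p
        using good_X[of n \<omega>]
        by (auto simp: good_def less_Suc_eq source_upd)
      show "emeasure (P n \<omega>) {p. (fun_upd \<omega> n p) \<in> {\<omega> \<in> space (PiM {0..<Suc n} N). good (Suc n) \<omega>}} =
          indicator {\<omega> \<in> space (PiM {0..<n} N). good n \<omega>} \<omega>"
      proof (cases "good n \<omega>")
        case True
        have "emeasure (measure_pmf (K y)) (set_pmf (K y)) = 1" for y
          by (simp add: measure_pmf.emeasure_eq_1_AE AE_measure_pmf)
        with True show ?thesis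
          using \<omega> upd by (simp add: sp eq P_def)
      qed (use \<omega> upd in \<open>simp add: sp eq P_def\<close>)
    qed
    also have "\<dots> = emeasure (?C n) {\<omega> \<in> space (PiM {0..<n} N). good n \<omega>}"
      by (intro nn_integral_indicator) (use good_sets'[of n n] sets_C in simp)
    finally show ?case using Suc by simp
  qed
  have cyl_sets: "{\<omega> \<in> space (PiM {0..<n} N). good n \<omega> \<and> (\<forall>i<n. \<omega> i = w i)} \<in> sets (PiM {0..<n} N)" for n w
  proof -
    have "Measurable.pred (PiM {0..<n} N) (\<lambda>\<omega>. \<omega> i = w i)" if "i \<in> {..<n}" for i
    proof -
      have [measurable]: "(\<lambda>\<omega>. \<omega> i) \<in> measurable (PiM {0..<n} N) (count_space UNIV)"
        using measurable_component_singleton[of i "{0..<n}" N] that by (simp add: N_def)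
      show ?thesis by measurable
    qed
    then have "Measurable.pred (PiM {0..<n} N) (\<lambda>\<omega>. \<forall>i\<in>{..<n}. \<omega> i = w i)"
      by (rule pred_intros_finite(3)[rotated]) simp_all
    then have "{\<omega> \<in> space (PiM {0..<n} N). \<forall>i<n. \<omega> i = w i} \<in> sets (PiM {0..<n} N)"
      unfolding pred_def Ball_def lessThan_iff .
    from sets.Int[OF this good_sets'[of n n]] show ?thesis
      by (simp add: Collect_conj_eq Int_ac)
  qed
  have em_cyl: "emeasure (?C n) {\<omega> \<in> space (PiM {0..<n} N). good n \<omega> \<and> (\<forall>i<n. \<omega> i = w i)} =
     ennreal (\<Prod>i<n. c (source x w i) (fst (w i)) (snd (w i)))" for n and w :: "nat \<Rightarrow> 'b \<times> 'x"
  proof (induction n)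
    case 0
    show ?case
      using prob_space.emeasure_space_1[OF prob_C[of 0]] by (simp add: good_def space_PiM)
  next
    case (Suc n)
    let ?A = "\<lambda>n. {\<omega> \<in> space (PiM {0..<n} N). good n \<omega> \<and> (\<forall>i<n. \<omega> i = w i)}"
    have "emeasure (?C (Suc n)) (?A (Suc n)) =
      (\<integral>\<^sup>+\<omega>. emeasure (P n \<omega>) {p. (fun_upd \<omega> n p) \<in> ?A (Suc n)} \<partial>?C n)"
      by (rule C_Suc) (rule cyl_sets)
    also have "\<dots> = (\<integral>\<^sup>+\<omega>. ennreal (c (source x w n) (fst (w n)) (snd (w n))) *
       indicator (?A n) \<omega> \<partial>?C n)"
    proof (intro nn_integral_cong)
      fix \<omega> assume "\<omega> \<in> space (?C n)"
      then have \<omega>: "\<omega> \<in> extensional {0..<n}" by (simp add: space_C sp)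
      have upd: "(fun_upd \<omega> n p) \<in> extensional {0..<Suc n}" for p
        using \<omega> by (auto simp: extensional_def)
      have eq: "good (Suc n) ((fun_upd \<omega> n p)) \<longleftrightarrow> good n \<omega> \<and> p \<in> set_pmf (K (source x \<omega> n))" for p
        using good_X[of n \<omega>]
        by (auto simp: good_def less_Suc_eq source_upd)
      have eq': "((fun_upd \<omega> n p) \<in> ?A (Suc n)) \<longleftrightarrow> \<omega> \<in> ?A n \<and> p = w n \<and> p \<in> set_pmf (K (source x \<omega> n))" for p
        using \<omega> upd by (auto simp: sp eq less_Suc_eq)
      show "emeasure (P n \<omega>) {p. (fun_upd \<omega> n p) \<in> ?A (Suc n)} =
          ennreal (c (source x w n) (fst (w n)) (snd (w n))) * indicator (?A n) \<omega>"
      proof (cases "\<omega> \<in> ?A n")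
        case True
        have src: "source x \<omega> n = source x w n"
          using True by (cases n) auto
        have X': "source x w n \<in> X"
          using good_X[of n \<omega>] True src by auto
        have "emeasure (P n \<omega>) {p. (fun_upd \<omega> n p) \<in> ?A (Suc n)} =
            emeasure (measure_pmf (K (source x w n))) ({w n} \<inter> set_pmf (K (source x w n)))"
          unfolding eq' P_def src using True by (intro arg_cong2[where f = emeasure]) auto
        also have "\<dots> = emeasure (measure_pmf (K (source x w n))) {w n}"
          by (rule emeasure_Int_set_pmf)
        also have "\<dots> = ennreal (c (source x w n) (fst (w n)) (snd (w n)))"
          by (simp add: emeasure_pmf_single pmf_K[OF X'])
        finally show ?thesis using True by simp
      next
        case False
        then have "{p. fun_upd \<omega> n p \<in> ?A (Suc n)} = {}"
          using eq' by blast
        then show ?thesis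
          by (simp only: emeasure_empty indicator_simps(2)[OF False] mult_zero_right)
      qed
    qed
    also have "\<dots> = ennreal (c (source x w n) (fst (w n)) (snd (w n))) * emeasure (?C n) (?A n)"
      by (intro nn_integral_cmult_indicator) (use cyl_sets[of n w] sets_C in simp)
    also have "\<dots> = ennreal (\<Prod>i<Suc n. c (source x w i) (fst (w i)) (snd (w i)))"
    proof (cases "source x w n \<in> X")
      case True
      show ?thesis
        using nonneg[OF True] by (simp add: Suc ennreal_mult' mult.commute)
    next
      case False
      have "?A n = {}"
      proof -
        have "False" if "\<omega> \<in> ?A n" for \<omega>
        proof -
          have "source x \<omega> n = source x w n"
            using that by (cases n) auto
          with False good_X[of n \<omega>] that show False by auto
        qed
        then show ?thesis by blast
      qed
      moreover have "(\<Prod>i<n. c (source x w i) (fst (w i)) (snd (w i))) = 0"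
      proof (rule ccontr)
        assume nz: "(\<Prod>i<n. c (source x w i) (fst (w i)) (snd (w i))) \<noteq> 0"
        have "source x w i \<in> X" if "i \<le> n" for i
          using that
        proof (induction i)
          case (Suc i)
          then show ?case using nz closed[of "source x w i" "fst (w i)" "snd (w i)"] by auto
        qed (use X in simp)
        with False show False by simp
      qed
      ultimately show ?thesis
        by (simp only: prod.lessThan_Suc emeasure_empty mult_zero_left mult_zero_right ennreal_0)
    qed
    finally show ?case .
  qed

  define L where "L = IT.PF.lim"
  have sets_L: "sets L = sets (PiM UNIV N)"
    unfolding L_def by simp
  have sp_L: "space L = UNIV"
    using sets_eq_imp_space_eq[OF sets_L] by (simp add: sp)
  have L_lift: "emeasure L {\<omega>. restrict \<omega> {0..<n} \<in> Y} = emeasure (?C n) Y"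
      "{\<omega>. restrict \<omega> {0..<n} \<in> Y} \<in> sets L"
    if Y: "Y \<in> sets (PiM {0..<n} N)" for n Y
  proof -
    have emb: "prod_emb UNIV N {0..<n} Y = {\<omega>. restrict \<omega> {0..<n} \<in> Y}"
      by (auto simp: prod_emb_def N_def)
    have "emeasure L (prod_emb UNIV N {0..<n} Y) = emeasure (IT.CI {0..<n}) Y"
      unfolding L_def by (rule IT.lim) (use Y in auto)
    also have "\<dots> = emeasure (?C n) (prod_emb {0..<n} N {0..<n} Y)"
      by (rule IT.emeasure_CI) (use Y in auto)
    also have "prod_emb {0..<n} N {0..<n} Y = Y"
      using sets.sets_into_space[OF Y] by (simp add: prod_emb_id space_PiM)
    finally show "emeasure L {\<omega>. restrict \<omega> {0..<n} \<in> Y} = emeasure (?C n) Y"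
      by (simp add: emb)
    show "{\<omega>. restrict \<omega> {0..<n} \<in> Y} \<in> sets L"
      unfolding emb[symmetric] sets_L by (rule measurable_prod_emb) (use Y in auto)
  qed
  have good_restrict: "good n (restrict \<omega> {0..<n}) \<longleftrightarrow> good n \<omega>" for n \<omega>
  proof -
    have "source x (restrict \<omega> {0..<n}) i = source x \<omega> i" if "i < n" for i
      using that by (cases i) auto
    then show ?thesis by (auto simp: good_def)
  qed
  have Runs_eq: "Runs c x = (\<Inter>n. {\<omega>. good n \<omega>})"
  proof (intro set_eqI iffI)
    fix \<omega> assume "\<omega> \<in> Runs c x"
    then have nz: "c (source x \<omega> n) (fst (\<omega> n)) (snd (\<omega> n)) \<noteq> 0" for n
      by (simp add: Runs_def)
    have "source x \<omega> n \<in> X" for n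
    proof (induction n)
      case (Suc n)
      then show ?case using nz[of n] closed[of "source x \<omega> n" "fst (\<omega> n)" "snd (\<omega> n)"] by simp
    qed (use X in simp)
    then show "\<omega> \<in> (\<Inter>n. {\<omega>. good n \<omega>})"
      using nz by (auto simp: good_def set_pmf_iff pmf_K)
  next
    fix \<omega> assume "\<omega> \<in> (\<Inter>n. {\<omega>. good n \<omega>})"
    then have "good (Suc n) \<omega>" for n by auto
    then have "source x \<omega> n \<in> X \<and> \<omega> n \<in> set_pmf (K (source x \<omega> n))" for n
      unfolding good_def by blast
    then have "c (source x \<omega> n) (fst (\<omega> n)) (snd (\<omega> n)) \<noteq> 0" for n
      by (metis pmf_K set_pmf_iff)
    then show "\<omega> \<in> Runs c x"
      by (simp add: Runs_def)
  qed
  have good_L: "{\<omega>. good n \<omega>} \<in> sets L" "emeasure L {\<omega>. good n \<omega>} = 1" for n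
    using L_lift[OF good_sets'[of n n]] em_good[of n] by (simp_all add: sp good_restrict)
  interpret L: prob_space L
    by standard (use good_L(2)[of 0] in \<open>simp add: sp_L good_def\<close>)
  have Runs_L: "Runs c x \<in> sets L"
    unfolding Runs_eq by (rule sets.countable_INT) (use good_L in auto)
  have AE_Runs: "AE \<omega> in L. \<omega> \<in> Runs c x"
  proof -
    have "AE \<omega> in L. good n \<omega>" for n
      using L.AE_in_set_eq_1[OF good_L(1)[of n]] good_L(2)[of n]
      by (simp add: L.emeasure_eq_measure)
    then show ?thesis unfolding Runs_eq by (simp add: AE_all_countable)
  qed
  have Run_L: "Run c x ys \<in> sets L" "emeasure L (Run c x ys) = ennreal (path_prob c x ys)" for ys
  proof -
    let ?n = "length ys"
    let ?Y = "{\<omega> \<in> space (PiM {0..<?n} N). good ?n \<omega> \<and> (\<forall>i<?n. \<omega> i = ys ! i)}"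
    let ?Z = "{\<omega>. good ?n \<omega> \<and> (\<forall>i<?n. \<omega> i = ys ! i)}"
    have eq: "{\<omega>. restrict \<omega> {0..<?n} \<in> ?Y} = ?Z"
      by (auto simp: sp good_restrict)
    have Z: "?Z \<in> sets L" "emeasure L ?Z = ennreal (path_prob c x ys)"
      using L_lift[OF cyl_sets[of ?n "nth ys"]] em_cyl[of ?n "nth ys"]
      unfolding eq path_prob_conv_prod by simp_all
    have Run_eq: "Run c x ys = ?Z \<inter> Runs c x"
      by (auto simp: Run_def Runs_eq)
    show "Run c x ys \<in> sets L"
      unfolding Run_eq using Z Runs_L by auto
    have "emeasure L (?Z \<inter> Runs c x) = emeasure L ?Z"
      by (rule emeasure_eq_AE) (use AE_Runs Z Runs_L in auto)
    with Z show "emeasure L (Run c x ys) = ennreal (path_prob c x ys)"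
      by (simp add: Run_eq)
  qed
  have sub: "range (Run c x) \<subseteq> Pow (Runs c x)" by (auto simp: Run_def)
  have "sigma_sets (Runs c x) (range (Run c x)) \<subseteq> sets L"
  proof
    fix Y assume "Y \<in> sigma_sets (Runs c x) (range (Run c x))"
    then show "Y \<in> sets L"
      by induction (use Runs_L Run_L in auto)
  qed
  then have le: "sets (run_measure c x) \<subseteq> sets L"
    unfolding run_measure_def by (simp add: sets_extend_measure[OF sub])
  show ?thesis
  proof (rule emeasure_extend_measure[OF run_measure_def, where \<mu>' = "emeasure L"])
    show "countably_additive (sets (run_measure c x)) (emeasure L)"
      using emeasure_countably_additive[of L] le unfolding countably_additive_def by blast
  qed (use sub Run_L in \<open>auto simp: positive_def\<close>)
qed

lemma infsum_ennreal_eq_nn_integral: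
  fixes g :: "'x \<Rightarrow> ennreal"
  assumes "countable E"
  shows "infsum g E = (\<integral>\<^sup>+t. g t \<partial>count_space E)"
proof (cases "finite E")
  case True
  then show ?thesis by (simp add: nn_integral_count_space_finite)
next
  case False
  then have h: "bij_betw (from_nat_into E) UNIV E"
    using assms by (rule bij_betw_from_nat_into[rotated])
  have "((\<lambda>n. g (from_nat_into E n)) has_sum infsum (\<lambda>n. g (from_nat_into E n)) UNIV) UNIV"
    by (intro has_sum_infsum nonneg_summable_on_complete) simp
  from sums_unique[OF has_sum_imp_sums[OF this]]
  have "infsum (\<lambda>n. g (from_nat_into E n)) UNIV = (\<integral>\<^sup>+t. g t \<partial>count_space E)"
    by (simp add: nn_integral_bij_count_space[OF h, symmetric] nn_integral_count_space_nat)
  then show ?thesis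
    by (simp add: infsum_reindex_bij_betw[OF h])
qed

lemma last_conf_extend [simp]: "last_conf (extend \<pi> a t) = t"
  by (cases \<pi>) simp

lemma extend_eq_iff [simp]: "extend \<pi> a t = extend \<pi> a' t' \<longleftrightarrow> a = a' \<and> t = t'"
  by (cases \<pi>) simp

lemma last_conf_paths: "\<pi> \<in> paths M \<Longrightarrow> last_conf \<pi> \<in> Conf M"
  by (induction rule: paths.induct) (auto simp: step_def)

lemma countable_paths:
  assumes "is_wts M"
  shows "countable (paths M)"
proof (rule countable_subset)
  show "paths M \<subseteq> Conf M \<times> lists (Act M \<times> Conf M)"
  proof
    fix \<pi> assume "\<pi> \<in> paths M"
    then show "\<pi> \<in> Conf M \<times> lists (Act M \<times> Conf M)"
    proof induction
      case (extend \<pi> a t)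
      then show ?case by (cases \<pi>) (auto simp: step_def)
    qed auto
  qed
  show "countable (Conf M \<times> lists (Act M \<times> Conf M))"
    using assms by (auto simp: is_wts_def)
qed

lemma induced_chain_nonneg:
  assumes "is_mdp M q"
  shows "0 \<le> induced_chain M q f \<pi> b \<pi>'"
  using assms
  by (auto simp: induced_chain_def is_mdp_def is_wts_def step_def split: option.split
      intro!: mult_nonneg_nonneg divide_nonneg_pos)

lemma induced_chain_closed:
  assumes "induced_chain M q f \<pi> b \<pi>' \<noteq> 0"
  shows "\<pi>' \<in> paths M"
  using assms by (auto simp: induced_chain_def split: option.splits if_splits intro: paths.extend)

lemma induced_chain_stochastic:
  fixes M :: "('s, 'a) wts"
  assumes mdp: "is_mdp M q" and f: "is_adversary M f" and \<pi>: "\<pi> \<in> paths M"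
  shows "(\<integral>\<^sup>+(b, \<pi>'). ennreal (induced_chain M q f \<pi> b \<pi>') \<partial>count_space UNIV) = 1"
proof (cases "terminal M (last_conf \<pi>)")
  case True
  have "(\<integral>\<^sup>+(b, \<pi>'). ennreal (induced_chain M q f \<pi> b \<pi>') \<partial>count_space UNIV) =
      (\<integral>\<^sup>+p. indicator {(None :: 'a option, \<pi>)} p \<partial>count_space UNIV)"
  proof (intro arg_cong[where f = "nn_integral _"] ext)
    fix p :: "'a option \<times> ('s, 'a) path"
    obtain b \<pi>' where p: "p = (b, \<pi>')" by (cases p)
    show "(case p of (b, \<pi>') \<Rightarrow> ennreal (induced_chain M q f \<pi> b \<pi>')) = indicator {(None, \<pi>)} p"
      unfolding p using True \<pi> by (cases b) (auto simp: induced_chain_def terminal_def)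
  qed
  then show ?thesis by simp
next
  case False
  let ?s = "last_conf \<pi>"
  let ?g = "\<lambda>(b, \<pi>'). ennreal (induced_chain M q f \<pi> b \<pi>')"
  let ?h = "\<lambda>(a, t). (Some a, extend \<pi> a t)"
  have s: "?s \<in> Conf M" using \<pi> by (rule last_conf_paths)
  have q: "0 < q" using mdp by (simp add: is_mdp_def)
  have h: "bij_betw ?h UNIV (range ?h)"
    by (auto simp: bij_betw_def inj_def)
  have g0: "?g p = 0" if "p \<notin> range ?h" for p
  proof -
    obtain b \<pi>' where p: "p = (b, \<pi>')" by (cases p)
    show ?thesis
      using that False unfolding p
      by (cases b) (auto simp: induced_chain_def image_iff)
  qed
  have "(\<integral>\<^sup>+p. ?g p \<partial>count_space UNIV) = (\<integral>\<^sup>+p. ?g p \<partial>count_space (range ?h))"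
    by (rule nn_integral_count_space_eq) (use g0 in auto)
  also have "\<dots> = (\<integral>\<^sup>+p. ?g (?h p) \<partial>count_space UNIV)"
    by (rule nn_integral_bij_count_space[OF h, symmetric])
  also have "\<dots> = (\<integral>\<^sup>+p. (case p of (a, t) \<Rightarrow> ?g (?h (a, t))) \<partial>count_space UNIV)"
    by (intro nn_integral_cong) auto
  also have "\<dots> = (\<integral>\<^sup>+a. (\<integral>\<^sup>+t. ?g (?h (a, t)) \<partial>count_space UNIV) \<partial>count_space UNIV)"
    by (subst nn_integral_fst_count_space[symmetric]) simp
  also have "\<dots> = (\<integral>\<^sup>+a. ennreal (pmf (f \<pi>) a) \<partial>count_space UNIV)"
  proof (intro nn_integral_cong)
    fix a
    show "(\<integral>\<^sup>+t. ?g (?h (a, t)) \<partial>count_space UNIV) = ennreal (pmf (f \<pi>) a)"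
    proof (cases "pmf (f \<pi>) a = 0")
      case True
      have "?g (?h (a, t)) = 0" for t
        using True by (auto simp: induced_chain_def)
      with True show ?thesis by simp
    next
      case a: False
      then have "a \<in> set_pmf (f \<pi>)" by (simp add: set_pmf_iff)
      with f \<pi> have aA: "a \<in> Act M" by (auto simp: is_adversary_def)
      from f \<pi> a False obtain t0 where t0: "t0 \<in> Conf M" "wt M ?s a t0 \<noteq> 0"
        unfolding is_adversary_def by blast
      have nn: "0 \<le> wt M ?s a t" if "t \<in> Conf M" for t
        using mdp s aA that by (auto simp: is_mdp_def is_wts_def)
      have sum: "wt_sum M ?s a (Conf M) = (\<integral>\<^sup>+t. ennreal (wt M ?s a t) \<partial>count_space (Conf M))"
        unfolding wt_sum_def
        by (rule infsum_ennreal_eq_nn_integral) (use mdp in \<open>simp add: is_mdp_def is_wts_def\<close>)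
      have "wt_sum M ?s a (Conf M) \<noteq> 0"
      proof
        assume "wt_sum M ?s a (Conf M) = 0"
        then have "AE t in count_space (Conf M). ennreal (wt M ?s a t) = 0"
          unfolding sum by (subst (asm) nn_integral_0_iff_AE) auto
        with t0 nn[OF t0(1)] show False by (auto simp: AE_count_space)
      qed
      then have wq: "wt_sum M ?s a (Conf M) = ennreal q"
        using mdp s aA by (auto simp: is_mdp_def)
      have "(\<integral>\<^sup>+t. ?g (?h (a, t)) \<partial>count_space UNIV) =
          (\<integral>\<^sup>+t. ?g (?h (a, t)) \<partial>count_space (Conf M))"
        by (rule nn_integral_count_space_eq) (auto simp: induced_chain_def step_def)
      also have "\<dots> = (\<integral>\<^sup>+t. ennreal (pmf (f \<pi>) a / q) * ennreal (wt M ?s a t) \<partial>count_space (Conf M))"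
        using \<pi> s aA nn q
        by (intro nn_integral_cong) (auto simp: induced_chain_def step_def ennreal_mult[symmetric])
      also have "\<dots> = ennreal (pmf (f \<pi>) a / q) * ennreal q"
        by (subst nn_integral_cmult) (simp_all add: sum[symmetric] wq)
      also have "\<dots> = ennreal (pmf (f \<pi>) a)"
        using q by (simp add: ennreal_mult[symmetric])
      finally show ?thesis .
    qed
  qed
  also have "\<dots> = 1"
    by (simp add: nn_integral_pmf)
  finally show ?thesis .
qed

lemma emeasure_run_measure_induced_chain:
  assumes "is_mdp M q" "is_adversary M f" "s \<in> Conf M"
  shows "emeasure (run_measure (induced_chain M q f) (s, [])) (Run (induced_chain M q f) (s, []) xs) =
    ennreal (path_prob (induced_chain M q f) (s, []) xs)"
  using assms
  by (intro emeasure_run_measure[where X = "paths M"])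
     (auto simp: is_mdp_def countable_paths paths.start induced_chain_nonneg induced_chain_stochastic
       intro: induced_chain_closed)

lemma sets_run_measure_induced_chain:
  assumes "is_mdp M q"
  shows "(\<Union>xs\<in>Z. Run (induced_chain M q f) x xs) \<in> sets (run_measure (induced_chain M q f) x)"
proof -
  let ?c = "induced_chain M q f"
  let ?W = "lists (insert None (Some ` Act M) \<times> paths M)"
  have sub: "range (Run ?c x) \<subseteq> Pow (Runs ?c x)" by (auto simp: Run_def)
  have "xs \<in> ?W" if "\<omega> \<in> Run ?c x xs" for \<omega> xs
  proof -
    have nz: "?c (source x \<omega> n) (fst (\<omega> n)) (snd (\<omega> n)) \<noteq> 0" for n
      using that by (simp add: Run_def Runs_def)
    have "\<omega> n \<in> insert None (Some ` Act M) \<times> paths M" for n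
      using nz[of n] induced_chain_closed[OF nz[of n]]
      by (cases "\<omega> n")
         (auto simp: induced_chain_def step_def split: option.splits if_splits)
    moreover have "\<forall>i<length xs. \<omega> i = xs ! i" using that by (simp add: Run_def)
    ultimately show ?thesis by (metis in_listsI in_set_conv_nth)
  qed
  then have "(\<Union>xs\<in>Z. Run ?c x xs) = (\<Union>xs\<in>Z \<inter> ?W. Run ?c x xs)" by blast
  moreover have "countable ?W"
    using assms by (auto simp: is_mdp_def countable_paths is_wts_def)
  moreover have "Run ?c x xs \<in> sets (run_measure ?c x)" for xs
    unfolding run_measure_def by (simp add: sets_extend_measure[OF sub] sigma_sets.Basic)
  ultimately show ?thesis
    by (metis (no_types, lifting) countable_Int2 sets.countable_UN'')
qed

end

(*
  Idea: the weight of a trace, i.e. the total probability of the finite paths with that trace, is the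
  same from any two paths with equal traces and bisimilar ends. This goes by induction on the
  trace: since the adversary is observational, both paths see the same distribution over actions, and
  the successors can be grouped into equivalence classes, on each of which the weight of the
  remaining trace is constant and to which both ends move with the same probability. A trace
  event is the disjoint union of the cylinders of the finite paths whose trace is a prefix-minimal
  element of the event, so its probability is a sum of weights of traces.
*)
theory Submission
  imports Defs
begin

section \<open>Regrouping sums along a map\<close>

text \<open>Each \<open>F x\<close> is spread over all \<open>y\<close>, only \<open>y = h x\<close>
  contributing; then the two sums are exchanged. It serves twice: to group successors by equivalence
  class and finite paths by trace.\<close>

lemma nn_integral_count_space_fibres:
  fixes F :: "'x \<Rightarrow> ennreal" and h :: "'x \<Rightarrow> 'y"
  shows "(\<integral>\<^sup>+x. F x \<partial>count_space UNIV) =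
    (\<integral>\<^sup>+y. (\<integral>\<^sup>+x. F x * indicator {y} (h x) \<partial>count_space UNIV) \<partial>count_space UNIV)"
proof -
  have "F x = (\<integral>\<^sup>+y. F x * indicator {y} (h x) \<partial>count_space UNIV)" for x
  proof -
    have "(\<integral>\<^sup>+y. F x * indicator {y} (h x) \<partial>count_space UNIV) =
        (\<integral>\<^sup>+y. F x * indicator {h x} y \<partial>count_space UNIV)"
      by (intro nn_integral_cong) (auto simp: indicator_def)
    then show ?thesis by (simp add: nn_integral_cmult)
  qed
  then have "(\<integral>\<^sup>+x. F x \<partial>count_space UNIV) =
      (\<integral>\<^sup>+x. (\<integral>\<^sup>+y. F x * indicator {y} (h x) \<partial>count_space UNIV) \<partial>count_space UNIV)"
    by simp
  also have "\<dots> = (\<integral>\<^sup>+y. (\<integral>\<^sup>+x. F x * indicator {y} (h x) \<partial>count_space UNIV) \<partial>count_space UNIV)"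
    using nn_integral_fst_count_space[of "\<lambda>(x, y). F x * indicator {y} (h x)"]
      nn_integral_snd_count_space[of "\<lambda>(x, y). F x * indicator {y} (h x)"] by simp
  finally show ?thesis .
qed


section \<open>Weights of traces\<close>

text \<open>The sum runs over all lists, since those that are not paths of the chain have
  \<open>path_prob\<close> equal to 0. Values in \<open>ennreal\<close> let it exist for every
  \<open>c\<close>.\<close>

definition trace_weight :: "('x \<Rightarrow> 'b \<Rightarrow> 'x \<Rightarrow> real) \<Rightarrow> 'b list \<Rightarrow> 'x \<Rightarrow> ennreal" where
  "trace_weight c bs x =
     (\<integral>\<^sup>+xs. ennreal (path_prob c x xs) * indicator {bs} (map fst xs) \<partial>count_space UNIV)"

lemma trace_weight_Nil:
  fixes c :: "'x \<Rightarrow> 'b \<Rightarrow> 'x \<Rightarrow> real"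
  shows "trace_weight c [] x = 1"
proof -
  have "trace_weight c [] x = (\<integral>\<^sup>+xs. indicator {[] :: ('b \<times> 'x) list} xs \<partial>count_space UNIV)"
    unfolding trace_weight_def by (intro nn_integral_cong) (auto simp: indicator_def)
  then show ?thesis by simp
qed

text \<open>The lists with labels \<open>b # bs\<close> are exactly those of the form
  \<open>(b, y) # ys\<close> with \<open>ys\<close> labelled by \<open>bs\<close>, so the sum splits
  over the first target \<open>y\<close>. Nonnegativity makes \<open>ennreal\<close> multiplicative
  on the path probabilities.\<close>

lemma trace_weight_Cons:
  assumes nonneg: "\<And>x b y. 0 \<le> c x b y"
  shows "trace_weight c (b # bs) x =
    (\<integral>\<^sup>+y. ennreal (c x b y) * trace_weight c bs y \<partial>count_space UNIV)"
proof -
  let ?g = "\<lambda>xs. ennreal (path_prob c x xs) * indicator {b # bs} (map fst xs)"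
  let ?h = "\<lambda>(y, ys). (b, y) # ys"
  have h: "bij_betw ?h UNIV (range ?h)"
    by (auto simp: bij_betw_def inj_def)
  have pp: "0 \<le> path_prob c y ys" for y ys
    by (induction ys arbitrary: y) (auto simp: nonneg)
  have "trace_weight c (b # bs) x = (\<integral>\<^sup>+xs. ?g xs \<partial>count_space (range ?h))"
    unfolding trace_weight_def
  proof (rule nn_integral_count_space_eq)
    fix xs :: "('b \<times> 'a) list" assume "xs \<in> UNIV - range ?h"
    then have "map fst xs \<noteq> b # bs" by (auto simp: map_eq_Cons_conv image_iff)
    then show "?g xs = 0" by (simp add: indicator_def)
  qed auto
  also have "\<dots> = (\<integral>\<^sup>+p. ?g (?h p) \<partial>count_space UNIV)"
    by (rule nn_integral_bij_count_space[OF h, symmetric])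
  also have "\<dots> = (\<integral>\<^sup>+p. (case p of (y, ys) \<Rightarrow> ?g (?h (y, ys))) \<partial>count_space UNIV)"
    by (intro nn_integral_cong) auto
  also have "\<dots> = (\<integral>\<^sup>+y. (\<integral>\<^sup>+ys. ?g (?h (y, ys)) \<partial>count_space UNIV) \<partial>count_space UNIV)"
    by (subst nn_integral_fst_count_space[symmetric]) simp
  also have "\<dots> = (\<integral>\<^sup>+y. ennreal (c x b y) * trace_weight c bs y \<partial>count_space UNIV)"
    unfolding trace_weight_def
    by (intro nn_integral_cong, subst nn_integral_cmult[symmetric])
       (auto intro!: nn_integral_cong simp: indicator_def ennreal_mult[OF nonneg pp])
  finally show ?thesis .
qed

lemma trace_extend [simp]: "trace (extend \<pi> a t) = trace \<pi> @ [a]"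
  by (cases \<pi>) simp

text \<open>From \<open>\<pi>\<close> the label \<open>Some a\<close> leads only to one-step
  extensions of \<open>\<pi>\<close>, and these correspond bijectively to their end configurations.
  The sum over chain states thus becomes a sum over \<open>Conf M\<close>, to which bisimulation
  applies.\<close>

lemma trace_weight_induced_chain_Cons:
  assumes mdp: "is_mdp M q" and \<pi>: "\<pi> \<in> paths M" and a: "a \<in> Act M"
  shows "trace_weight (induced_chain M q f) (Some a # bs) \<pi> =
    ennreal (pmf (f \<pi>) a / q) *
      (\<integral>\<^sup>+t. ennreal (wt M (last_conf \<pi>) a t) *
         trace_weight (induced_chain M q f) bs (extend \<pi> a t) \<partial>count_space (Conf M))"
proof -
  let ?c = "induced_chain M q f" and ?s = "last_conf \<pi>"
  let ?h = "extend \<pi> a"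
  let ?g = "\<lambda>\<rho>. ennreal (?c \<pi> (Some a) \<rho>) * trace_weight ?c bs \<rho>"
  have s: "?s \<in> Conf M" using \<pi> by (rule last_conf_paths)
  have q: "0 < q" using mdp by (simp add: is_mdp_def)
  have nn: "0 \<le> wt M ?s a t" if "t \<in> Conf M" for t
    using mdp s a that by (auto simp: is_mdp_def is_wts_def)
  have "trace_weight ?c (Some a # bs) \<pi> = (\<integral>\<^sup>+\<rho>. ?g \<rho> \<partial>count_space UNIV)"
    by (rule trace_weight_Cons) (rule induced_chain_nonneg[OF mdp])
  also have "\<dots> = (\<integral>\<^sup>+\<rho>. ?g \<rho> \<partial>count_space (?h ` Conf M))"
    by (rule nn_integral_count_space_eq) (auto simp: induced_chain_def step_def image_iff)
  also have "\<dots> = (\<integral>\<^sup>+t. ?g (?h t) \<partial>count_space (Conf M))"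
    by (rule nn_integral_bij_count_space[symmetric]) (auto simp: bij_betw_def inj_on_def)
  also have "\<dots> = (\<integral>\<^sup>+t. ennreal (pmf (f \<pi>) a / q) * (ennreal (wt M ?s a t) *
         trace_weight ?c bs (?h t)) \<partial>count_space (Conf M))"
    using \<pi> s a nn q
    by (intro nn_integral_cong)
       (auto simp: induced_chain_def step_def ennreal_mult[symmetric] mult.assoc[symmetric])
  finally show ?thesis
    by (simp add: nn_integral_cmult)
qed

section \<open>Invariance of trace weights under bisimulation\<close>

text \<open>Grouping the successors by class pulls out the factor \<open>g E\<close> and leaves
  \<open>wt_sum M r a E\<close>, on which bisimilar configurations agree. Taking \<open>g\<close> on
  classes encodes a function of \<open>t\<close> that is constant on each class.\<close>

lemma nn_integral_wt_bisimulation: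
  assumes wts: "is_wts M" and R: "is_bisimulation M R" and "(s, s') \<in> R" and a: "a \<in> Act M"
  shows "(\<integral>\<^sup>+t. ennreal (wt M s a t) * g (R `` {t}) \<partial>count_space (Conf M)) =
    (\<integral>\<^sup>+t. ennreal (wt M s' a t) * g (R `` {t}) \<partial>count_space (Conf M))"
proof -
  have eqv: "equiv (Conf M) R" using R by (simp add: is_bisimulation_def)
  have classes: "(\<integral>\<^sup>+t. ennreal (wt M r a t) * g (R `` {t}) \<partial>count_space (Conf M)) =
      (\<integral>\<^sup>+E. (if E \<in> Conf M // R then g E * wt_sum M r a E else 0) \<partial>count_space UNIV)" for r
  proof -
    have "(\<integral>\<^sup>+t. ennreal (wt M r a t) * g (R `` {t}) \<partial>count_space (Conf M)) =
      (\<integral>\<^sup>+t. ennreal (wt M r a t) * g (R `` {t}) * indicator (Conf M) t \<partial>count_space UNIV)"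
      by (simp add: nn_integral_count_space_indicator)
    also have "\<dots> = (\<integral>\<^sup>+E. (\<integral>\<^sup>+t. ennreal (wt M r a t) * g (R `` {t}) * indicator (Conf M) t *
        indicator {E} (R `` {t}) \<partial>count_space UNIV) \<partial>count_space UNIV)"
      by (rule nn_integral_count_space_fibres)
    \<comment> \<open>The fibre of \<open>t\<close> over \<open>E\<close> is \<open>E\<close> itself
      if \<open>E\<close> is a class, and has no element in \<open>Conf M\<close> otherwise.\<close>
    also have "\<dots> = (\<integral>\<^sup>+E. (if E \<in> Conf M // R then g E * wt_sum M r a E else 0) \<partial>count_space UNIV)"
    proof (intro nn_integral_cong)
      fix E
      let ?F = "\<lambda>t. ennreal (wt M r a t) * g (R `` {t}) * indicator (Conf M) t * indicator {E} (R `` {t})"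
      show "(\<integral>\<^sup>+t. ?F t \<partial>count_space UNIV) = (if E \<in> Conf M // R then g E * wt_sum M r a E else 0)"
      proof (cases "E \<in> Conf M // R")
        case True
        have E: "E \<subseteq> Conf M" using in_quotient_imp_subset[OF eqv True] .
        then have "countable E" using wts countable_subset by (auto simp: is_wts_def)
        then have "wt_sum M r a E = (\<integral>\<^sup>+t. ennreal (wt M r a t) * indicator E t \<partial>count_space UNIV)"
          unfolding wt_sum_def
          by (simp add: infsum_ennreal_eq_nn_integral nn_integral_count_space_indicator)
        moreover have F: "?F t = g E * (ennreal (wt M r a t) * indicator E t)" for t
        proof (cases "t \<in> Conf M")
          case t: True
          have "R `` {t} = E \<longleftrightarrow> t \<in> E"
            using True t eqv
            by (metis equiv_class_self quotientI quotient_eqI Image_singleton_iff)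
          with t show ?thesis by (auto simp: indicator_def mult.commute)
        qed (use E in \<open>auto simp: indicator_def\<close>)
        ultimately show ?thesis using True by (simp only: F) (simp add: nn_integral_cmult)
      next
        case False
        then have F: "?F t = 0" for t by (auto simp: indicator_def quotient_def)
        show ?thesis using False by (simp only: F) simp
      qed
    qed
    finally show ?thesis .
  qed
  have "wt_sum M s a E = wt_sum M s' a E" if "E \<in> Conf M // R" for E
    using R assms(3) a that unfolding is_bisimulation_def by blast
  then show ?thesis unfolding classes by (intro nn_integral_cong) simp
qed

text \<open>Arbitrary paths are allowed, not only those of length 0, because after one transition
  the induction hypothesis is needed for the extended paths, whose traces again agree.\<close>

lemma trace_weight_bisimilar:
  assumes mdp: "is_mdp M q" and obs: "observational M f" and R: "is_bisimulation M R"
    and "set as \<subseteq> Act M"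
    and "\<pi> \<in> paths M" "\<pi>' \<in> paths M" "trace \<pi> = trace \<pi>'" "(last_conf \<pi>, last_conf \<pi>') \<in> R"
  shows "trace_weight (induced_chain M q f) (map Some as) \<pi> =
    trace_weight (induced_chain M q f) (map Some as) \<pi>'"
  using assms(4-)
proof (induction as arbitrary: \<pi> \<pi>')
  case Nil
  then show ?case by (simp add: trace_weight_Nil)
next
  case (Cons a as)
  let ?W = "trace_weight (induced_chain M q f) (map Some as)"
  have eqv: "equiv (Conf M) R" using R by (simp add: is_bisimulation_def)
  have a: "a \<in> Act M" using Cons.prems by simp
  \<comment> \<open>The weight of an extension depends on the whole path. To make it a function of
    the class of its end, one path with the extended trace is chosen for each class. If there is
    none, \<open>rep E\<close> is unspecified, but then each \<open>t\<close> in \<open>E\<close> is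
    reached with weight 0.\<close>
  define rep where "rep E = (SOME \<rho>. \<rho> \<in> paths M \<and> trace \<rho> = trace \<pi> @ [a] \<and> last_conf \<rho> \<in> E)" for E
  have rep: "?W \<rho> = ?W (rep (R `` {last_conf \<rho>}))" if \<rho>: "\<rho> \<in> paths M" "trace \<rho> = trace \<pi> @ [a]" for \<rho>
  proof -
    have "last_conf \<rho> \<in> R `` {last_conf \<rho>}"
      using eqv last_conf_paths[OF \<rho>(1)] by (rule equiv_class_self)
    with \<rho> have "\<exists>\<rho>'. \<rho>' \<in> paths M \<and> trace \<rho>' = trace \<pi> @ [a] \<and> last_conf \<rho>' \<in> R `` {last_conf \<rho>}"
      by blast
    then have "rep (R `` {last_conf \<rho>}) \<in> paths M \<and> trace (rep (R `` {last_conf \<rho>})) = trace \<pi> @ [a] \<and>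
        last_conf (rep (R `` {last_conf \<rho>})) \<in> R `` {last_conf \<rho>}"
      unfolding rep_def by (rule someI_ex)
    then show ?thesis using Cons.prems(1) \<rho> by (intro Cons.IH) auto
  qed
  \<comment> \<open>\<open>rep\<close> refers to \<open>\<pi>\<close> only through its trace, so the
    same choice works for both \<open>\<pi>\<close> and \<open>\<pi>'\<close>.\<close>
  have W: "trace_weight (induced_chain M q f) (map Some (a # as)) \<rho> =
      ennreal (pmf (f \<rho>) a / q) *
      (\<integral>\<^sup>+t. ennreal (wt M (last_conf \<rho>) a t) * ?W (rep (R `` {t})) \<partial>count_space (Conf M))"
    if \<rho>: "\<rho> \<in> paths M" "trace \<rho> = trace \<pi>" for \<rho>
  proof -
    have "ennreal (wt M (last_conf \<rho>) a t) * ?W (extend \<rho> a t) =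
        ennreal (wt M (last_conf \<rho>) a t) * ?W (rep (R `` {t}))" if t: "t \<in> Conf M" for t
    proof (cases "wt M (last_conf \<rho>) a t = 0")
      case False
      then have "extend \<rho> a t \<in> paths M"
        using \<rho> t a by (intro paths.extend) (simp_all add: step_def last_conf_paths)
      then show ?thesis using rep[of "extend \<rho> a t"] \<rho> by simp
    qed simp
    then have "(\<integral>\<^sup>+t. ennreal (wt M (last_conf \<rho>) a t) * ?W (extend \<rho> a t) \<partial>count_space (Conf M)) =
        (\<integral>\<^sup>+t. ennreal (wt M (last_conf \<rho>) a t) * ?W (rep (R `` {t})) \<partial>count_space (Conf M))"
      by (intro nn_integral_cong) (simp only: space_count_space)
    then show ?thesis
      by (simp only: list.map trace_weight_induced_chain_Cons[OF mdp \<rho>(1) a])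
  qed
  \<comment> \<open>Here observationality enters: the action probabilities in front of the two sums
    agree.\<close>
  have "f \<pi> = f \<pi>'" using obs Cons.prems(2-4) unfolding observational_def by blast
  moreover have "is_wts M" using mdp by (simp add: is_mdp_def)
  ultimately show ?case
    using W[OF Cons.prems(2) refl] W[OF Cons.prems(3) Cons.prems(4)[symmetric]]
      nn_integral_wt_bisimulation[OF _ R Cons.prems(5) a, where g = "\<lambda>E. ?W (rep E)"] by simp
qed


section \<open>Probabilities of trace events\<close>

text \<open>This prefix-free part of \<open>B\<close> describes the same event as \<open>B\<close>,
  but as a disjoint union of cylinders.\<close>

definition prefix_minimal :: "'b list set \<Rightarrow> 'b list set" where
  "prefix_minimal B = {b \<in> B. \<forall>n<length b. take n b \<notin> B}"

text \<open>A run in the cylinder of \<open>xs\<close> lies in the cylinder of every prefix of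
  \<open>xs\<close>, in particular of the shortest one with trace in \<open>B\<close>.\<close>

lemma UN_Run_prefix_minimal:
  "(\<Union>xs\<in>{xs. map fst xs \<in> B}. Run c x xs) = (\<Union>xs\<in>{xs. map fst xs \<in> prefix_minimal B}. Run c x xs)"
proof (intro equalityI subsetI)
  fix \<omega> assume "\<omega> \<in> (\<Union>xs\<in>{xs. map fst xs \<in> B}. Run c x xs)"
  then obtain xs where xs: "map fst xs \<in> B" "\<omega> \<in> Run c x xs" by auto
  define n where "n = (LEAST n. take n (map fst xs) \<in> B)"
  have n: "take n (map fst xs) \<in> B"
    unfolding n_def by (rule LeastI[of _ "length xs"]) (use xs in simp)
  have "take m (map fst xs) \<notin> B" if "m < n" for m
    using that not_less_Least unfolding n_def by blast
  then have "map fst (take n xs) \<in> prefix_minimal B"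
    using n by (auto simp: prefix_minimal_def take_map)
  moreover have "\<omega> \<in> Run c x (take n xs)" using xs(2) by (auto simp: Run_def)
  ultimately show "\<omega> \<in> (\<Union>xs\<in>{xs. map fst xs \<in> prefix_minimal B}. Run c x xs)" by blast
qed (auto simp: prefix_minimal_def)

text \<open>If two cylinders share a run, the shorter list is a prefix of the longer. Their traces
  are then comparable, and minimality forces equal lengths.\<close>

lemma disjoint_family_on_Run_prefix_minimal:
  fixes x :: 'x and B :: "'b list set"
  shows "disjoint_family_on (Run c x) {xs. map fst xs \<in> prefix_minimal B}"
proof -
  have *: "xs = ys"
    if "map fst xs \<in> prefix_minimal B" "map fst ys \<in> prefix_minimal B"
      and "\<omega> \<in> Run c x xs" "\<omega> \<in> Run c x ys" and le: "length xs \<le> length ys"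
    for xs ys :: "('b \<times> 'x) list" and \<omega>
  proof -
    have xs: "xs = take (length xs) ys"
      using that by (intro nth_equalityI) (auto simp: Run_def)
    then have "map fst xs = take (length xs) (map fst ys)" by (metis take_map)
    then have "\<not> length xs < length ys"
      using that(1,2) by (auto simp: prefix_minimal_def)
    with xs le show ?thesis by simp
  qed
  show ?thesis
    unfolding disjoint_family_on_def
  proof (intro ballI impI)
    fix xs ys :: "('b \<times> 'x) list"
    assume "xs \<in> {xs. map fst xs \<in> prefix_minimal B}"
      "ys \<in> {xs. map fst xs \<in> prefix_minimal B}" "xs \<noteq> ys"
    then show "Run c x xs \<inter> Run c x ys = {}"
      using *[of xs ys] *[of ys xs] by (cases "length xs \<le> length ys") auto
  qed
qed

text \<open>In this formula the start \<open>s\<close> enters only through the trace weights, so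
  starts can be compared trace by trace.\<close>

lemma emeasure_trace_event:
  fixes M :: "('s, 'a) wts"
  assumes mdp: "is_mdp M q" and f: "is_adversary M f" and s: "s \<in> Conf M"
    and B: "B \<subseteq> lists (Some ` Act M)"
  shows "emeasure (run_measure (induced_chain M q f) (s, []))
      (\<Union>xs\<in>{xs. map fst xs \<in> B}. Run (induced_chain M q f) (s, []) xs) =
    (\<integral>\<^sup>+bs. trace_weight (induced_chain M q f) bs (s, []) \<partial>count_space (prefix_minimal B))"
proof -
  let ?c = "induced_chain M q f" and ?x = "(s, []) :: ('s, 'a) path"
  let ?\<mu> = "run_measure ?c ?x"
  \<comment> \<open>Countable additivity needs a countable index set, while the types may be
    uncountable. Lists outside \<open>?I\<close> have empty cylinders.\<close>
  let ?I = "{xs. map fst xs \<in> prefix_minimal B} \<inter> lists (Some ` Act M \<times> paths M)"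
  have I: "xs \<in> ?I" if "map fst xs \<in> prefix_minimal B" "Run ?c ?x xs \<noteq> {}" for xs
  proof -
    from that(2) obtain \<omega> where \<omega>: "\<omega> \<in> Run ?c ?x xs" by auto
    have "xs ! i \<in> Some ` Act M \<times> paths M" if i: "i < length xs" for i
    proof -
      have "map fst xs ! i \<in> Some ` Act M"
        using \<open>map fst xs \<in> prefix_minimal B\<close> B i nth_mem[of i "map fst xs"]
        unfolding prefix_minimal_def by auto
      moreover have "snd (xs ! i) \<in> paths M"
      proof -
        have "?c (source ?x \<omega> i) (fst (\<omega> i)) (snd (\<omega> i)) \<noteq> 0" "\<omega> i = xs ! i"
          using \<omega> i unfolding Run_def Runs_def by blast+
        then show ?thesis
          using induced_chain_closed by metis
      qed
      ultimately show ?thesis using i by (cases "xs ! i") auto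
    qed
    then have "set xs \<subseteq> Some ` Act M \<times> paths M" by (metis in_set_conv_nth subsetI)
    then show ?thesis using that(1) by blast
  qed
  have "(\<Union>xs\<in>{xs. map fst xs \<in> B}. Run ?c ?x xs) = (\<Union>xs\<in>?I. Run ?c ?x xs)"
    by (subst UN_Run_prefix_minimal) (use I in blast)
  also have "emeasure ?\<mu> \<dots> = (\<integral>\<^sup>+xs. emeasure ?\<mu> (Run ?c ?x xs) \<partial>count_space ?I)"
  proof (rule emeasure_UN_countable)
    show "Run ?c ?x xs \<in> sets ?\<mu>" for xs
      using sets_run_measure_induced_chain[OF mdp, of f ?x "{xs}"] by simp
    show "countable ?I"
      using mdp by (intro countable_Int2) (auto simp: is_mdp_def countable_paths is_wts_def)
    show "disjoint_family_on (Run ?c ?x) ?I"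
      by (rule disjoint_family_on_mono[OF _ disjoint_family_on_Run_prefix_minimal[where B = B]]) auto
  qed
  also have "\<dots> = (\<integral>\<^sup>+xs. emeasure ?\<mu> (Run ?c ?x xs) \<partial>count_space {xs. map fst xs \<in> prefix_minimal B})"
  proof (rule nn_integral_count_space_eq)
    fix xs assume "xs \<in> {xs. map fst xs \<in> prefix_minimal B} - ?I"
    then have "Run ?c ?x xs = {}" using I[of xs] by blast
    then show "emeasure ?\<mu> (Run ?c ?x xs) = 0" by simp
  qed blast
  also have "\<dots> = (\<integral>\<^sup>+xs. ennreal (path_prob ?c ?x xs) \<partial>count_space {xs. map fst xs \<in> prefix_minimal B})"
    by (simp add: emeasure_run_measure_induced_chain[OF mdp f s])
  also have "\<dots> = (\<integral>\<^sup>+xs. ennreal (path_prob ?c ?x xs) *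
      indicator {xs. map fst xs \<in> prefix_minimal B} xs \<partial>count_space UNIV)"
    by (simp add: nn_integral_count_space_indicator)
  also have "\<dots> = (\<integral>\<^sup>+bs. (\<integral>\<^sup>+xs. ennreal (path_prob ?c ?x xs) *
      indicator {xs. map fst xs \<in> prefix_minimal B} xs * indicator {bs} (map fst xs)
      \<partial>count_space UNIV) \<partial>count_space UNIV)"
    by (rule nn_integral_count_space_fibres)
  \<comment> \<open>On the fibre over \<open>bs\<close>, membership of the trace in
    \<open>prefix_minimal B\<close> depends on \<open>bs\<close> alone and factors out of the inner
    sum.\<close>
  also have "\<dots> = (\<integral>\<^sup>+bs. trace_weight ?c bs ?x * indicator (prefix_minimal B) bs \<partial>count_space UNIV)"
    unfolding trace_weight_def
    by (subst nn_integral_multc[symmetric], simp, intro nn_integral_cong)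
       (simp split: split_indicator)
  also have "\<dots> = (\<integral>\<^sup>+bs. trace_weight ?c bs ?x \<partial>count_space (prefix_minimal B))"
    by (simp add: nn_integral_count_space_indicator)
  finally show ?thesis .
qed

theorem theorem14:
  fixes M :: "('s, 'a) wts" and q :: real and f :: "('s, 'a) path \<Rightarrow> 'a pmf"
    and R :: "('s \<times> 's) set" and u v :: 's and T :: "'a list set"
  assumes "is_mdp M q"
    and "is_adversary M f" and "observational M f"
    and "is_bisimulation M R"
    and "(u, v) \<in> R"
    and "T \<subseteq> lists (Act M)"
  shows "trace_prob M q f v T = trace_prob M q f u T"
proof -
  have "equiv (Conf M) R" using assms(4) by (simp add: is_bisimulation_def)
  then have uv: "u \<in> Conf M" "v \<in> Conf M" using assms(5) by (auto dest: equiv_type)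
  have B: "map Some ` T \<subseteq> lists (Some ` Act M)" using assms(6) by fastforce
  \<comment> \<open>The length-0 paths at \<open>u\<close> and \<open>v\<close> both have the empty
    trace, and their ends are related by \<open>R\<close>.\<close>
  have "trace_weight (induced_chain M q f) bs (v, []) = trace_weight (induced_chain M q f) bs (u, [])"
    if bs: "bs \<in> prefix_minimal (map Some ` T)" for bs
  proof -
    from bs obtain as where as: "as \<in> T" "bs = map Some as" by (auto simp: prefix_minimal_def)
    have "set as \<subseteq> Act M" using as assms(6) by auto
    then show ?thesis
      unfolding as(2)
      by (rule trace_weight_bisimilar[OF assms(1,3,4), symmetric])
         (use uv assms(5) in \<open>auto intro: paths.start\<close>)
  qed
  then show ?thesis
    unfolding trace_prob_def Let_def measure_def
      emeasure_trace_event[OF assms(1,2) uv(1) B] emeasure_trace_event[OF assms(1,2) uv(2) B]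
    by (intro arg_cong[where f = enn2real] nn_integral_cong) simp
qed

end
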